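(* The smooth affine variety $\mathbb{C}\times\mathbb{C}^*$, with coordinates $(z,w)$, equipped with the algebraic symplectic form $dz\wedge\frac{dw}{w}$ has the algebraic Hamiltonian density property.
   Context: For a smooth affine complex variety $X$ with an algebraic symplectic form $\omega$, an algebraic vector field $V$ is Hamiltonian if $i_V\omega=df$ for some regular function $f$ on $X$; these form the Lie algebra $\mathrm{HVF}^{\mathrm{alg}}_\omega(X)$ under the commutator. A vector field is complete if its flow exists for all complex times from every initial point. $(X,\omega)$ has the algebraic Hamiltonian density property if the Lie algebra generated by the complete algebraic Hamiltonian vector fields on $X$ equals $\mathrm{HVF}^{\mathrm{alg}}_\omega(X)$. *)

theory Defs
  imports "HOL-Analysis.Analysis" "HOL-Computational_Algebra.Polynomial"
begin

text \<open>
  Open subvarieties \<open>X\<close> of the affine plane, given by the set of points \<open>X\<close> and the ring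
  \<open>R\<close> of regular functions on \<open>X\<close>.  All tangent spaces are identified with the plane by means
  of the coordinates \<open>(z, w)\<close>.  Functions and vector fields on \<open>X\<close> are represented by total
  functions vanishing outside \<open>X\<close>, so that equality of functions on \<open>X\<close> is equality in HOL.
\<close>

type_synonym plane = "complex \<times> complex"
type_synonym vfield = "plane \<Rightarrow> plane"
type_synonym one_form = "plane \<Rightarrow> plane \<Rightarrow> complex"
type_synonym two_form = "plane \<Rightarrow> plane \<Rightarrow> plane \<Rightarrow> complex"

definition dz :: one_form where
  "dz p u = fst u"

definition dw :: one_form where
  "dw p u = snd u"

definition wedge :: "one_form \<Rightarrow> one_form \<Rightarrow> two_form" where
  "wedge \<alpha> \<beta> p u v = \<alpha> p u * \<beta> p v - \<alpha> p v * \<beta> p u"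

text \<open>
  Every algebraic 2-form on \<open>X\<close> is \<open>\<rho> dz \<and> dw\<close> with \<open>\<rho>\<close> regular; it is closed because there
  are no nonzero 3-forms on a surface.
\<close>

definition algebraic_symplectic_form ::
    "plane set \<Rightarrow> (plane \<Rightarrow> complex) set \<Rightarrow> two_form \<Rightarrow> bool" where
  "algebraic_symplectic_form X R \<omega> \<longleftrightarrow>
     (\<exists>\<rho>\<in>R. \<forall>p\<in>X. \<forall>u v. \<omega> p u v = \<rho> p * wedge dz dw p u v) \<and>
     (\<forall>p\<in>X. \<forall>u. (\<forall>v. \<omega> p u v = 0) \<longrightarrow> u = 0)"

definition algebraic_vfields :: "(plane \<Rightarrow> complex) set \<Rightarrow> vfield set" where
  "algebraic_vfields R = {V. (\<lambda>p. fst (V p)) \<in> R \<and> (\<lambda>p. snd (V p)) \<in> R}"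

text \<open>
  The condition \<open>i\<^sub>V \<omega> = df\<close>.  As \<open>X\<close> is open, the derivative at a point of \<open>X\<close> does not
  depend on the values of \<open>f\<close> outside \<open>X\<close>.
\<close>

definition HVF_alg ::
    "plane set \<Rightarrow> (plane \<Rightarrow> complex) set \<Rightarrow> two_form \<Rightarrow> vfield set" where
  "HVF_alg X R \<omega> =
     {V \<in> algebraic_vfields R. \<exists>f\<in>R. \<forall>p\<in>X. (f has_derivative (\<lambda>v. \<omega> p (V p) v)) (at p)}"

definition complete_vfield :: "plane set \<Rightarrow> vfield \<Rightarrow> bool" where
  "complete_vfield X V \<longleftrightarrow>
     (\<forall>p\<in>X. \<exists>\<gamma> :: complex \<Rightarrow> plane. \<gamma> 0 = p \<and>
        (\<forall>t. \<gamma> t \<in> X \<and>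
             ((\<lambda>s. fst (\<gamma> s)) has_field_derivative fst (V (\<gamma> t))) (at t) \<and>
             ((\<lambda>s. snd (\<gamma> s)) has_field_derivative snd (V (\<gamma> t))) (at t)))"

text \<open>
  The coordinate expression of the commutator \<open>[V, W] f = V (W f) - W (V f)\<close> of derivations.
\<close>

definition lie_bracket :: "plane set \<Rightarrow> vfield \<Rightarrow> vfield \<Rightarrow> vfield" where
  "lie_bracket X V W =
     (\<lambda>p. if p \<in> X then frechet_derivative W (at p) (V p) - frechet_derivative V (at p) (W p)
          else 0)"

inductive_set lie_generated :: "plane set \<Rightarrow> vfield set \<Rightarrow> vfield set"
  for X :: "plane set" and S :: "vfield set" where
  base: "V \<in> S \<Longrightarrow> V \<in> lie_generated X S"
| zero: "(\<lambda>p. 0) \<in> lie_generated X S"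
| add: "V \<in> lie_generated X S \<Longrightarrow> W \<in> lie_generated X S \<Longrightarrow> (\<lambda>p. V p + W p) \<in> lie_generated X S"
| scale: "V \<in> lie_generated X S \<Longrightarrow> (\<lambda>p. (c * fst (V p), c * snd (V p))) \<in> lie_generated X S"
| bracket: "V \<in> lie_generated X S \<Longrightarrow> W \<in> lie_generated X S \<Longrightarrow>
    lie_bracket X V W \<in> lie_generated X S"

definition algebraic_hamiltonian_density_property ::
    "plane set \<Rightarrow> (plane \<Rightarrow> complex) set \<Rightarrow> two_form \<Rightarrow> bool" where
  "algebraic_hamiltonian_density_property X R \<omega> \<longleftrightarrow>
     lie_generated X {V \<in> HVF_alg X R \<omega>. complete_vfield X V} = HVF_alg X R \<omega>"

definition C_Cstar :: "plane set" where
  "C_Cstar = UNIV \<times> (UNIV - {0})"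

text \<open>
  The coordinate ring \<open>\<complex>[z, w, w\<^sup>-\<^sup>1]\<close>, as the localisation of \<open>\<complex>[z][w]\<close> at \<open>w\<close>: the
  polynomial \<open>P\<close> in \<open>w\<close> has coefficients in \<open>\<complex>[z]\<close> and is evaluated first at the constant
  \<open>w\<close> and then at \<open>z\<close>.
\<close>

definition regular_C_Cstar :: "(plane \<Rightarrow> complex) set" where
  "regular_C_Cstar =
     {f. \<exists>(P :: complex poly poly) (n :: nat).
           f = (\<lambda>(z, w). if w = 0 then 0 else poly (poly P [:w:]) z / w ^ n)}"

definition omega_C_Cstar :: two_form where
  "omega_C_Cstar = wedge dz (\<lambda>p u. dw p u / snd p)"

end

theory Submission
  imports Defs
begin

text \<open>
  On \<open>\<complex> \<times> \<complex>\<^sup>*\<close> the equation \<open>i\<^sub>V \<omega> = df\<close> has the unique solution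
  \<open>V\<^sub>f = w f\<^sub>w \<partial>\<^sub>z - w f\<^sub>z \<partial>\<^sub>w\<close>, so the Hamiltonian fields are exactly the \<open>V\<^sub>f\<close> with \<open>f\<close> regular
  (\<open>HVF_alg_eq_hamiltonian_fields\<close>), and \<open>f \<mapsto> V\<^sub>f\<close> is linear and carries the Poisson bracket
  \<open>{f, g} = w (f\<^sub>w g\<^sub>z - f\<^sub>z g\<^sub>w)\<close> to the commutator (\<open>lie_bracket_hamiltonian\<close>).  In particular
  the Hamiltonian fields are closed under the commutator, which gives one inclusion.

  For the other inclusion, every regular function is a linear combination of the Laurent monomials
  \<open>z\<^sup>k w\<^sup>m\<close> with \<open>k \<ge> 0\<close> and \<open>m\<close> an integer.  The fields of \<open>z\<^sup>k\<close> and of \<open>w\<^sup>m\<close> are shears, whose flows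
  are explicit and defined for all times.  When \<open>m \<noteq> 0\<close>, the identity
  \<open>{w\<^sup>m, z\<^sup>k\<^sup>+\<^sup>1} = m (k + 1) z\<^sup>k w\<^sup>m\<close> produces the remaining monomials from a single commutator of
  two complete fields; when \<open>m = 0\<close> the monomial \<open>z\<^sup>k\<close> is itself one of the complete generators.
\<close>

section \<open>The ring of Laurent polynomials in w over polynomials in z\<close>

definition laurent_monomial :: "nat \<Rightarrow> int \<Rightarrow> plane \<Rightarrow> complex" where
  "laurent_monomial k m p = (if snd p = 0 then 0 else fst p ^ k * snd p powi m)"

lemma mem_C_Cstar_iff: "p \<in> C_Cstar \<longleftrightarrow> snd p \<noteq> 0"
  by (cases p) (auto simp: C_Cstar_def)

lemma open_C_Cstar: "open C_Cstar"
  unfolding C_Cstar_def by (intro open_Times) auto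

lemma regularI:
  assumes "\<And>z w. w \<noteq> 0 \<Longrightarrow> f (z, w) = poly (poly P [:w:]) z / w ^ n"
    and "\<And>z. f (z, 0) = 0"
  shows "f \<in> regular_C_Cstar"
  unfolding regular_C_Cstar_def using assms
  by (intro CollectI exI[of _ P] exI[of _ n]) auto

lemma regularE:
  assumes "f \<in> regular_C_Cstar"
  obtains P n where "\<And>z w. w \<noteq> 0 \<Longrightarrow> f (z, w) = poly (poly P [:w:]) z / w ^ n"
    and "\<And>z. f (z, 0) = 0"
  using assms unfolding regular_C_Cstar_def by auto

lemma regular_vanishes:
  assumes "f \<in> regular_C_Cstar" "p \<notin> C_Cstar"
  shows "f p = 0"
  using assms by (cases p) (auto simp: mem_C_Cstar_iff elim: regularE)

lemma regular_zero: "(\<lambda>p. 0) \<in> regular_C_Cstar"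
  by (rule regularI[where P = 0 and n = 0]) auto

lemma regular_add:
  assumes "f \<in> regular_C_Cstar" "g \<in> regular_C_Cstar"
  shows "(\<lambda>p. f p + g p) \<in> regular_C_Cstar"
proof -
  obtain P n where f: "\<And>z w. w \<noteq> 0 \<Longrightarrow> f (z, w) = poly (poly P [:w:]) z / w ^ n"
    "\<And>z. f (z, 0) = 0" using regularE[OF assms(1)] by blast
  obtain Q k where g: "\<And>z w. w \<noteq> 0 \<Longrightarrow> g (z, w) = poly (poly Q [:w:]) z / w ^ k"
    "\<And>z. g (z, 0) = 0" using regularE[OF assms(2)] by blast
  show ?thesis
    by (rule regularI[where P = "P * [:0, 1:] ^ k + Q * [:0, 1:] ^ n" and n = "n + k"])
       (auto simp: f g power_add field_simps)
qed

lemma regular_mult: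
  assumes "f \<in> regular_C_Cstar" "g \<in> regular_C_Cstar"
  shows "(\<lambda>p. f p * g p) \<in> regular_C_Cstar"
proof -
  obtain P n where f: "\<And>z w. w \<noteq> 0 \<Longrightarrow> f (z, w) = poly (poly P [:w:]) z / w ^ n"
    "\<And>z. f (z, 0) = 0" using regularE[OF assms(1)] by blast
  obtain Q k where g: "\<And>z w. w \<noteq> 0 \<Longrightarrow> g (z, w) = poly (poly Q [:w:]) z / w ^ k"
    "\<And>z. g (z, 0) = 0" using regularE[OF assms(2)] by blast
  show ?thesis
    by (rule regularI[where P = "P * Q" and n = "n + k"]) (auto simp: f g power_add)
qed

lemma regular_scale:
  assumes "f \<in> regular_C_Cstar"
  shows "(\<lambda>p. c * f p) \<in> regular_C_Cstar"
proof -
  obtain P n where f: "\<And>z w. w \<noteq> 0 \<Longrightarrow> f (z, w) = poly (poly P [:w:]) z / w ^ n"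
    "\<And>z. f (z, 0) = 0" using regularE[OF assms] by blast
  show ?thesis
    by (rule regularI[where P = "[:[:c:]:] * P" and n = n]) (auto simp: f)
qed

lemma regular_snd: "snd \<in> regular_C_Cstar"
  by (rule regularI[where P = "[:0, 1:]" and n = 0]) auto

lemma regular_laurent_monomial: "laurent_monomial k m \<in> regular_C_Cstar"
  by (rule regularI[where P = "monom (monom 1 k) (nat m)" and n = "nat (- m)"])
     (auto simp: laurent_monomial_def poly_monom power_int_def inverse_eq_divide power_one_over)

lemma regular_diff:
  assumes "f \<in> regular_C_Cstar" "g \<in> regular_C_Cstar"
  shows "(\<lambda>p. f p - g p) \<in> regular_C_Cstar"
  using regular_add[OF assms(1) regular_scale[OF assms(2), of "-1"]] by simp

text \<open>
  The Laurent monomials span the ring: this is the double expansion of \<open>P\<close> in powers of \<open>w\<close> and of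
  \<open>z\<close>, divided termwise by \<open>w\<^sup>n\<close>.  It reduces every linear assertion to a single monomial.
\<close>

lemma regular_induct [consumes 1, case_names zero add monomial]:
  assumes "f \<in> regular_C_Cstar"
    and zero: "Q (\<lambda>p. 0)"
    and add: "\<And>f g. f \<in> regular_C_Cstar \<Longrightarrow> g \<in> regular_C_Cstar \<Longrightarrow> Q f \<Longrightarrow> Q g \<Longrightarrow>
      Q (\<lambda>p. f p + g p)"
    and monomial: "\<And>c k m. Q (\<lambda>p. c * laurent_monomial k m p)"
  shows "Q f"
proof -
  obtain P n where f: "\<And>z w. w \<noteq> 0 \<Longrightarrow> f (z, w) = poly (poly P [:w:]) z / w ^ n"
    "\<And>z. f (z, 0) = 0" using regularE[OF assms(1)] by blast
  have sum: "(\<lambda>p. \<Sum>i\<in>I. h i p) \<in> regular_C_Cstar \<and> Q (\<lambda>p. \<Sum>i\<in>I. h i p)"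
    if "finite I" and "\<And>i. i \<in> I \<Longrightarrow> h i \<in> regular_C_Cstar \<and> Q (h i)"
    for I :: "nat set" and h :: "nat \<Rightarrow> plane \<Rightarrow> complex"
    using that by (induction I rule: finite_induct) (auto simp: regular_zero zero regular_add add)
  let ?term = "\<lambda>i j p. coeff (coeff P i) j * laurent_monomial j (int i - int n) p"
  have "f p = (\<Sum>i\<le>degree P. \<Sum>j\<le>degree (coeff P i). ?term i j p)" for p
  proof (cases p)
    case (Pair z w)
    show ?thesis
    proof (cases "w = 0")
      case True
      then show ?thesis by (simp add: Pair f laurent_monomial_def)
    next
      case False
      have "poly (poly P [:w:]) z = (\<Sum>i\<le>degree P. poly (coeff P i) z * w ^ i)"
        by (simp add: poly_altdef[of P] poly_sum)
      also have "\<dots> = (\<Sum>i\<le>degree P. \<Sum>j\<le>degree (coeff P i). coeff (coeff P i) j * z ^ j * w ^ i)"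
        by (simp add: poly_altdef sum_distrib_right)
      finally show ?thesis
        using False
        by (simp add: Pair f laurent_monomial_def sum_divide_distrib power_int_diff mult.assoc)
    qed
  qed
  then have "f = (\<lambda>p. \<Sum>i\<le>degree P. \<Sum>j\<le>degree (coeff P i). ?term i j p)"
    by (rule ext)
  moreover have "Q (\<lambda>p. \<Sum>i\<le>degree P. \<Sum>j\<le>degree (coeff P i). ?term i j p)"
    by (intro conjunct2[OF sum[OF finite_atMost]] sum finite_atMost conjI monomial
        regular_scale regular_laurent_monomial)
  ultimately show ?thesis
    by simp
qed

section \<open>Partial derivatives of regular functions\<close>

definition partial_z :: "(plane \<Rightarrow> complex) \<Rightarrow> plane \<Rightarrow> complex" where
  "partial_z f p = (if p \<in> C_Cstar then frechet_derivative f (at p) (1, 0) else 0)"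

definition partial_w :: "(plane \<Rightarrow> complex) \<Rightarrow> plane \<Rightarrow> complex" where
  "partial_w f p = (if p \<in> C_Cstar then frechet_derivative f (at p) (0, 1) else 0)"

lemma partials_eqI:
  assumes "p \<in> C_Cstar" "(f has_derivative (\<lambda>v. a * fst v + b * snd v)) (at p)"
  shows "partial_z f p = a" "partial_w f p = b"
  using assms by (auto simp: partial_z_def partial_w_def simp flip: frechet_derivative_at)

lemma laurent_monomial_has_derivative:
  assumes "p \<in> C_Cstar"
  shows "(laurent_monomial k m has_derivative
    (\<lambda>v. of_nat k * laurent_monomial (k - 1) m p * fst v
       + of_int m * laurent_monomial k (m - 1) p * snd v)) (at p)"
proof -
  have "((\<lambda>q. fst q ^ k * snd q powi m) has_derivative
    (\<lambda>v. of_nat k * laurent_monomial (k - 1) m p * fst v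
       + of_int m * laurent_monomial k (m - 1) p * snd v)) (at p)"
    using assms
    by (auto intro!: derivative_eq_intros
        simp: mem_C_Cstar_iff laurent_monomial_def algebra_simps)
  then show ?thesis
    by (rule has_derivative_transform_within_open[OF _ open_C_Cstar assms])
       (auto simp: laurent_monomial_def mem_C_Cstar_iff)
qed

text \<open>
  The Frechet derivative in HOL is only real linear; on regular functions it is complex linear, so
  that it is determined by the two partial derivatives.
\<close>

lemma regular_has_derivative:
  assumes "f \<in> regular_C_Cstar" "p \<in> C_Cstar"
  shows "(f has_derivative (\<lambda>v. partial_z f p * fst v + partial_w f p * snd v)) (at p)"
proof -
  from assms(1) have "\<exists>a b. (f has_derivative (\<lambda>v. a * fst v + b * snd v)) (at p)"
  proof (induction rule: regular_induct)
    case zero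
    have "((\<lambda>p. 0) has_derivative (\<lambda>v. 0 * fst v + 0 * snd v)) (at p)"
      by simp
    then show ?case by blast
  next
    case (add f g)
    then obtain a b a' b' where
      "(f has_derivative (\<lambda>v. a * fst v + b * snd v)) (at p)"
      "(g has_derivative (\<lambda>v. a' * fst v + b' * snd v)) (at p)"
      by blast
    then have "((\<lambda>p. f p + g p) has_derivative (\<lambda>v. (a + a') * fst v + (b + b') * snd v)) (at p)"
      by (auto intro!: derivative_eq_intros simp: algebra_simps)
    then show ?case by blast
  next
    case (monomial c k m)
    have "((\<lambda>p. c * laurent_monomial k m p) has_derivative
      (\<lambda>v. (c * (of_nat k * laurent_monomial (k - 1) m p)) * fst v
         + (c * (of_int m * laurent_monomial k (m - 1) p)) * snd v)) (at p)"
      using has_derivative_mult_right[OF laurent_monomial_has_derivative[OF assms(2)], of c k m]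
      by (simp add: algebra_simps)
    then show ?case by blast
  qed
  then obtain a b where "(f has_derivative (\<lambda>v. a * fst v + b * snd v)) (at p)"
    by blast
  then show ?thesis
    using partials_eqI[OF assms(2)] by metis
qed

lemma partials_zero: "partial_z (\<lambda>p. 0) = (\<lambda>p. 0)" "partial_w (\<lambda>p. 0) = (\<lambda>p. 0)"
  by (auto simp: partial_z_def partial_w_def)

lemma partials_add:
  assumes "f \<in> regular_C_Cstar" "g \<in> regular_C_Cstar"
  shows "partial_z (\<lambda>p. f p + g p) = (\<lambda>p. partial_z f p + partial_z g p)"
    and "partial_w (\<lambda>p. f p + g p) = (\<lambda>p. partial_w f p + partial_w g p)"
proof -
  have "partial_z (\<lambda>p. f p + g p) p = partial_z f p + partial_z g p \<and>
        partial_w (\<lambda>p. f p + g p) p = partial_w f p + partial_w g p" for p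
  proof (cases "p \<in> C_Cstar")
    case True
    have "((\<lambda>p. f p + g p) has_derivative (\<lambda>v. (partial_z f p + partial_z g p) * fst v
        + (partial_w f p + partial_w g p) * snd v)) (at p)"
      using has_derivative_add[OF regular_has_derivative[OF assms(1) True]
          regular_has_derivative[OF assms(2) True]]
      by (simp add: algebra_simps)
    with partials_eqI[OF True] show ?thesis by blast
  qed (simp add: partial_z_def partial_w_def)
  then show "partial_z (\<lambda>p. f p + g p) = (\<lambda>p. partial_z f p + partial_z g p)"
    and "partial_w (\<lambda>p. f p + g p) = (\<lambda>p. partial_w f p + partial_w g p)"
    by auto
qed

lemma partials_scale:
  assumes "f \<in> regular_C_Cstar"
  shows "partial_z (\<lambda>p. c * f p) = (\<lambda>p. c * partial_z f p)"
    and "partial_w (\<lambda>p. c * f p) = (\<lambda>p. c * partial_w f p)"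
proof -
  have "partial_z (\<lambda>p. c * f p) p = c * partial_z f p \<and>
        partial_w (\<lambda>p. c * f p) p = c * partial_w f p" for p
  proof (cases "p \<in> C_Cstar")
    case True
    have "((\<lambda>p. c * f p) has_derivative
        (\<lambda>v. (c * partial_z f p) * fst v + (c * partial_w f p) * snd v)) (at p)"
      using has_derivative_mult_right[OF regular_has_derivative[OF assms True], of c]
      by (simp add: algebra_simps)
    with partials_eqI[OF True] show ?thesis by blast
  qed (simp add: partial_z_def partial_w_def)
  then show "partial_z (\<lambda>p. c * f p) = (\<lambda>p. c * partial_z f p)"
    and "partial_w (\<lambda>p. c * f p) = (\<lambda>p. c * partial_w f p)"
    by auto
qed

lemma partials_laurent_monomial:
  "partial_z (laurent_monomial k m) = (\<lambda>p. of_nat k * laurent_monomial (k - 1) m p)"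
  "partial_w (laurent_monomial k m) = (\<lambda>p. of_int m * laurent_monomial k (m - 1) p)"
proof -
  have "partial_z (laurent_monomial k m) p = of_nat k * laurent_monomial (k - 1) m p \<and>
        partial_w (laurent_monomial k m) p = of_int m * laurent_monomial k (m - 1) p" for p
  proof (cases "p \<in> C_Cstar")
    case True
    with partials_eqI[OF True laurent_monomial_has_derivative[OF True]] show ?thesis by blast
  next
    case False
    then show ?thesis
      by (simp add: partial_z_def partial_w_def regular_vanishes[OF regular_laurent_monomial])
  qed
  then show "partial_z (laurent_monomial k m) = (\<lambda>p. of_nat k * laurent_monomial (k - 1) m p)"
    "partial_w (laurent_monomial k m) = (\<lambda>p. of_int m * laurent_monomial k (m - 1) p)"
    by auto
qed

lemmas partials_simps = partials_zero partials_add partials_scale partials_laurent_monomial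
  regular_zero regular_add regular_scale regular_laurent_monomial

lemma regular_partials:
  assumes "f \<in> regular_C_Cstar"
  shows "partial_z f \<in> regular_C_Cstar" "partial_w f \<in> regular_C_Cstar"
  using assms by (induction rule: regular_induct) (simp_all add: partials_simps)

lemma partials_commute:
  assumes "f \<in> regular_C_Cstar"
  shows "partial_z (partial_w f) = partial_w (partial_z f)"
  using assms
  by (induction rule: regular_induct) (simp_all add: partials_simps regular_partials mult_ac)

section \<open>Hamiltonian vector fields and the Poisson bracket\<close>

definition hamiltonian :: "(plane \<Rightarrow> complex) \<Rightarrow> vfield" where
  "hamiltonian f p = (snd p * partial_w f p, - snd p * partial_z f p)"

definition poisson :: "(plane \<Rightarrow> complex) \<Rightarrow> (plane \<Rightarrow> complex) \<Rightarrow> plane \<Rightarrow> complex" where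
  "poisson f g p = snd p * (partial_w f p * partial_z g p - partial_z f p * partial_w g p)"

lemma regular_poisson:
  assumes "f \<in> regular_C_Cstar" "g \<in> regular_C_Cstar"
  shows "poisson f g \<in> regular_C_Cstar"
  unfolding poisson_def
  by (intro regular_mult regular_diff regular_partials assms regular_snd)

text \<open>
  Comparing the coefficients of \<open>dz\<close> and \<open>dw\<close> in \<open>i\<^sub>V \<omega> = df\<close> determines \<open>V\<close> on the surface, as
  \<open>w\<close> is invertible there; outside the surface both sides vanish by the convention on values.
\<close>

lemma HVF_alg_eq_hamiltonian_fields:
  "HVF_alg C_Cstar regular_C_Cstar omega_C_Cstar = hamiltonian ` regular_C_Cstar"
proof (intro equalityI subsetI)
  fix V
  assume "V \<in> HVF_alg C_Cstar regular_C_Cstar omega_C_Cstar"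
  then obtain f where V: "(\<lambda>p. fst (V p)) \<in> regular_C_Cstar" "(\<lambda>p. snd (V p)) \<in> regular_C_Cstar"
    and f: "f \<in> regular_C_Cstar"
    and der: "\<And>p. p \<in> C_Cstar \<Longrightarrow> (f has_derivative (\<lambda>v. omega_C_Cstar p (V p) v)) (at p)"
    by (auto simp: HVF_alg_def algebraic_vfields_def)
  have "V p = hamiltonian f p" for p
  proof (cases "p \<in> C_Cstar")
    case True
    have "omega_C_Cstar p (V p) = (\<lambda>v. - snd (V p) / snd p * fst v + fst (V p) / snd p * snd v)"
      by (auto simp: omega_C_Cstar_def wedge_def dz_def dw_def)
    with partials_eqI[OF True, of f] der[OF True]
    have "partial_z f p = - snd (V p) / snd p" "partial_w f p = fst (V p) / snd p"
      by metis+
    then show ?thesis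
      using True by (simp add: hamiltonian_def mem_C_Cstar_iff)
  next
    case False
    then show ?thesis
      using regular_vanishes[OF V(1) False] regular_vanishes[OF V(2) False]
      by (simp add: hamiltonian_def mem_C_Cstar_iff prod_eq_iff)
  qed
  with f show "V \<in> hamiltonian ` regular_C_Cstar"
    by blast
next
  fix V
  assume "V \<in> hamiltonian ` regular_C_Cstar"
  then obtain f where f: "f \<in> regular_C_Cstar" and V: "V = hamiltonian f"
    by blast
  have "(\<lambda>p. snd p * partial_w f p) \<in> regular_C_Cstar"
    "(\<lambda>p. snd p * partial_z f p) \<in> regular_C_Cstar"
    by (intro regular_mult regular_snd regular_partials f)+
  then have "V \<in> algebraic_vfields regular_C_Cstar"
    using regular_scale[of "\<lambda>p. snd p * partial_z f p" "-1"]
    by (simp add: V algebraic_vfields_def hamiltonian_def)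
  moreover have "(f has_derivative (\<lambda>v. omega_C_Cstar p (V p) v)) (at p)" if "p \<in> C_Cstar" for p
  proof -
    have "omega_C_Cstar p (V p) = (\<lambda>v. partial_z f p * fst v + partial_w f p * snd v)"
      using that
      by (auto simp: V hamiltonian_def omega_C_Cstar_def wedge_def dz_def dw_def mem_C_Cstar_iff)
    then show ?thesis
      using regular_has_derivative[OF f that] by simp
  qed
  ultimately show "V \<in> HVF_alg C_Cstar regular_C_Cstar omega_C_Cstar"
    unfolding HVF_alg_def using f by blast
qed

lemma hamiltonian_zero: "hamiltonian (\<lambda>p. 0) = (\<lambda>p. 0)"
  by (auto simp: hamiltonian_def partials_zero zero_prod_def)

lemma hamiltonian_add:
  assumes "f \<in> regular_C_Cstar" "g \<in> regular_C_Cstar"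
  shows "hamiltonian (\<lambda>p. f p + g p) = (\<lambda>p. hamiltonian f p + hamiltonian g p)"
  by (auto simp: hamiltonian_def partials_add[OF assms] algebra_simps)

lemma hamiltonian_scale:
  assumes "f \<in> regular_C_Cstar"
  shows "hamiltonian (\<lambda>p. c * f p) =
    (\<lambda>p. (c * fst (hamiltonian f p), c * snd (hamiltonian f p)))"
  by (auto simp: hamiltonian_def partials_scale[OF assms])

lemma hamiltonian_has_derivative:
  assumes "f \<in> regular_C_Cstar" "p \<in> C_Cstar"
  shows "(hamiltonian f has_derivative (\<lambda>v.
    (snd v * partial_w f p
       + snd p * (partial_z (partial_w f) p * fst v + partial_w (partial_w f) p * snd v),
     - (snd v * partial_z f p
       + snd p * (partial_z (partial_z f) p * fst v + partial_w (partial_z f) p * snd v)))))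
    (at p)"
proof -
  note der = regular_has_derivative[OF regular_partials(1)[OF assms(1)] assms(2)]
    regular_has_derivative[OF regular_partials(2)[OF assms(1)] assms(2)]
  show ?thesis
    unfolding hamiltonian_def
    by (rule has_derivative_Pair)
       (auto intro!: derivative_eq_intros der simp: algebra_simps)
qed

text \<open>
  The sign in \<open>poisson\<close> is the one forced by
  \<open>i\<^bsub>[V, W]\<^esub> \<omega> = d (\<omega>(W, V))\<close>, that is, \<open>[V\<^sub>f, V\<^sub>g] = V\<^sub>h\<close> with \<open>h = V\<^sub>f g\<close>.
  In coordinates the second-order terms agree by the symmetry of mixed partial derivatives.
\<close>

lemma lie_bracket_hamiltonian:
  assumes f: "f \<in> regular_C_Cstar" and g: "g \<in> regular_C_Cstar"
  shows "lie_bracket C_Cstar (hamiltonian f) (hamiltonian g) = hamiltonian (poisson f g)"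
proof
  fix p
  show "lie_bracket C_Cstar (hamiltonian f) (hamiltonian g) p = hamiltonian (poisson f g) p"
  proof (cases "p \<in> C_Cstar")
    case True
    note der = regular_has_derivative[OF regular_partials(1)[OF f] True]
      regular_has_derivative[OF regular_partials(2)[OF f] True]
      regular_has_derivative[OF regular_partials(1)[OF g] True]
      regular_has_derivative[OF regular_partials(2)[OF g] True]
    let ?hz = "snd p * (partial_w (partial_z f) p * partial_z g p
      + partial_w f p * partial_z (partial_z g) p
      - partial_z (partial_z f) p * partial_w g p
      - partial_z f p * partial_w (partial_z g) p)"
    let ?hw = "(partial_w f p * partial_z g p - partial_z f p * partial_w g p)
      + snd p * (partial_w (partial_w f) p * partial_z g p
      + partial_w f p * partial_w (partial_z g) p
      - partial_w (partial_z f) p * partial_w g p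
      - partial_z f p * partial_w (partial_w g) p)"
    have "(poisson f g has_derivative (\<lambda>v. ?hz * fst v + ?hw * snd v)) (at p)"
      unfolding poisson_def
      by (auto intro!: derivative_eq_intros der
          simp: partials_commute[OF f] partials_commute[OF g] algebra_simps)
    note h = partials_eqI[OF True this]
    note D = frechet_derivative_at[OF hamiltonian_has_derivative[OF f True], symmetric]
      frechet_derivative_at[OF hamiltonian_has_derivative[OF g True], symmetric]
    show ?thesis
      using True
      by (simp add: lie_bracket_def D hamiltonian_def[of _ p] h
          partials_commute[OF f] partials_commute[OF g] algebra_simps)
  next
    case False
    then show ?thesis
      by (simp add: lie_bracket_def hamiltonian_def mem_C_Cstar_iff zero_prod_def)
  qed
qed

section \<open>Complete shears and the generation of all monomials\<close>

text \<open>
  Along the flow of a function of \<open>z\<close> the coordinate \<open>z\<close> is constant, so \<open>w\<close> solves a linear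
  equation with constant coefficient; being rescaled by an exponential, it never reaches \<open>0\<close>.
\<close>

lemma complete_hamiltonian_power_z:
  "complete_vfield C_Cstar (hamiltonian (laurent_monomial k 0))"
  unfolding complete_vfield_def
proof
  fix p :: plane
  assume p: "p \<in> C_Cstar"
  obtain z w where zw: "p = (z, w)" "w \<noteq> 0"
    using p by (cases p) (auto simp: mem_C_Cstar_iff)
  let ?a = "of_nat k * z ^ (k - 1)"
  let ?\<gamma> = "\<lambda>t. (z, w * exp (- ?a * t))"
  have "?\<gamma> t \<in> C_Cstar" for t
    using zw by (simp add: mem_C_Cstar_iff)
  moreover have "((\<lambda>s. fst (?\<gamma> s)) has_field_derivative
      fst (hamiltonian (laurent_monomial k 0) (?\<gamma> t))) (at t)" for t
    by (simp add: hamiltonian_def partials_laurent_monomial)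
  moreover have "((\<lambda>s. snd (?\<gamma> s)) has_field_derivative
      snd (hamiltonian (laurent_monomial k 0) (?\<gamma> t))) (at t)" for t
    using zw
    by (auto intro!: derivative_eq_intros
        simp: hamiltonian_def partials_laurent_monomial laurent_monomial_def)
  ultimately show "\<exists>\<gamma>. \<gamma> 0 = p \<and> (\<forall>t. \<gamma> t \<in> C_Cstar \<and>
      ((\<lambda>s. fst (\<gamma> s)) has_field_derivative
        fst (hamiltonian (laurent_monomial k 0) (\<gamma> t))) (at t) \<and>
      ((\<lambda>s. snd (\<gamma> s)) has_field_derivative
        snd (hamiltonian (laurent_monomial k 0) (\<gamma> t))) (at t))"
    using zw by (intro exI[of _ ?\<gamma>]) auto
qed

lemma complete_hamiltonian_power_w:
  "complete_vfield C_Cstar (hamiltonian (laurent_monomial 0 m))"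
  unfolding complete_vfield_def
proof
  fix p :: plane
  assume p: "p \<in> C_Cstar"
  obtain z w where zw: "p = (z, w)" "w \<noteq> 0"
    using p by (cases p) (auto simp: mem_C_Cstar_iff)
  let ?a = "w * (of_int m * w powi (m - 1))"
  let ?\<gamma> = "\<lambda>t. (z + ?a * t, w)"
  have "?\<gamma> t \<in> C_Cstar" for t
    using zw by (simp add: mem_C_Cstar_iff)
  moreover have "((\<lambda>s. fst (?\<gamma> s)) has_field_derivative
      fst (hamiltonian (laurent_monomial 0 m) (?\<gamma> t))) (at t)" for t
    using zw
    by (auto intro!: derivative_eq_intros
        simp: hamiltonian_def partials_laurent_monomial laurent_monomial_def)
  moreover have "((\<lambda>s. snd (?\<gamma> s)) has_field_derivative
      snd (hamiltonian (laurent_monomial 0 m) (?\<gamma> t))) (at t)" for t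
    by (simp add: hamiltonian_def partials_laurent_monomial)
  ultimately show "\<exists>\<gamma>. \<gamma> 0 = p \<and> (\<forall>t. \<gamma> t \<in> C_Cstar \<and>
      ((\<lambda>s. fst (\<gamma> s)) has_field_derivative
        fst (hamiltonian (laurent_monomial 0 m) (\<gamma> t))) (at t) \<and>
      ((\<lambda>s. snd (\<gamma> s)) has_field_derivative
        snd (hamiltonian (laurent_monomial 0 m) (\<gamma> t))) (at t))"
    using zw by (intro exI[of _ ?\<gamma>]) auto
qed

lemma poisson_powers:
  "poisson (laurent_monomial 0 m) (laurent_monomial (Suc k) 0) =
    (\<lambda>p. of_int m * of_nat (Suc k) * laurent_monomial k m p)"
  by (auto simp: poisson_def partials_laurent_monomial laurent_monomial_def power_int_diff
      simp del: of_nat_Suc)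

abbreviation complete_hamiltonian_fields :: "vfield set" where
  "complete_hamiltonian_fields \<equiv>
    {V \<in> HVF_alg C_Cstar regular_C_Cstar omega_C_Cstar. complete_vfield C_Cstar V}"

lemma hamiltonian_monomial_generated:
  "hamiltonian (laurent_monomial k m) \<in> lie_generated C_Cstar complete_hamiltonian_fields"
proof -
  have power_z: "hamiltonian (laurent_monomial j 0)
      \<in> lie_generated C_Cstar complete_hamiltonian_fields" for j
    by (rule lie_generated.base)
       (simp add: HVF_alg_eq_hamiltonian_fields regular_laurent_monomial complete_hamiltonian_power_z)
  have power_w: "hamiltonian (laurent_monomial 0 m)
      \<in> lie_generated C_Cstar complete_hamiltonian_fields"
    by (rule lie_generated.base)
       (simp add: HVF_alg_eq_hamiltonian_fields regular_laurent_monomial complete_hamiltonian_power_w)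
  show ?thesis
  proof (cases "m = 0")
    case True
    with power_z show ?thesis by simp
  next
    case False
    define c :: complex where "c = of_int m * of_nat (Suc k)"
    let ?V = "hamiltonian (laurent_monomial k m)"
    have "c \<noteq> 0"
      using False by (simp add: c_def del: of_nat_Suc)
    have "lie_bracket C_Cstar (hamiltonian (laurent_monomial 0 m))
        (hamiltonian (laurent_monomial (Suc k) 0)) = (\<lambda>p. (c * fst (?V p), c * snd (?V p)))"
      by (simp only: lie_bracket_hamiltonian[OF regular_laurent_monomial regular_laurent_monomial]
          poisson_powers hamiltonian_scale[OF regular_laurent_monomial] c_def)
    with lie_generated.bracket[OF power_w power_z[of "Suc k"]]
    have "(\<lambda>p. (c * fst (?V p), c * snd (?V p)))
        \<in> lie_generated C_Cstar complete_hamiltonian_fields"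
      by simp
    from lie_generated.scale[OF this, of "inverse c"] \<open>c \<noteq> 0\<close>
    show ?thesis
      by (simp add: mult.assoc[symmetric])
  qed
qed

lemma hamiltonian_generated:
  assumes "f \<in> regular_C_Cstar"
  shows "hamiltonian f \<in> lie_generated C_Cstar complete_hamiltonian_fields"
  using assms
proof (induction rule: regular_induct)
  case zero
  show ?case
    by (simp only: hamiltonian_zero lie_generated.zero)
next
  case (add f g)
  then show ?case
    by (simp only: hamiltonian_add lie_generated.add)
next
  case (monomial c k m)
  show ?case
    by (simp only: hamiltonian_scale[OF regular_laurent_monomial]
        lie_generated.scale[OF hamiltonian_monomial_generated])
qed

lemma generated_hamiltonian:
  assumes "V \<in> lie_generated C_Cstar complete_hamiltonian_fields"
  shows "V \<in> hamiltonian ` regular_C_Cstar"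
  using assms
proof (induction rule: lie_generated.induct)
  case (base V)
  then show ?case
    by (simp add: HVF_alg_eq_hamiltonian_fields)
next
  case zero
  show ?case
    using hamiltonian_zero regular_zero by (metis image_eqI)
next
  case (add V W)
  then obtain f g where "f \<in> regular_C_Cstar" "g \<in> regular_C_Cstar"
    "V = hamiltonian f" "W = hamiltonian g"
    by blast
  then show ?case
    by (simp add: hamiltonian_add[symmetric] regular_add)
next
  case (scale V c)
  then obtain f where "f \<in> regular_C_Cstar" "V = hamiltonian f"
    by blast
  then show ?case
    by (simp add: hamiltonian_scale[symmetric] regular_scale)
next
  case (bracket V W)
  then obtain f g where "f \<in> regular_C_Cstar" "g \<in> regular_C_Cstar"
    "V = hamiltonian f" "W = hamiltonian g"
    by blast
  then show ?case
    by (simp add: lie_bracket_hamiltonian regular_poisson)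
qed

lemma algebraic_symplectic_form_omega_C_Cstar:
  "algebraic_symplectic_form C_Cstar regular_C_Cstar omega_C_Cstar"
  unfolding algebraic_symplectic_form_def
proof (intro conjI ballI allI impI)
  show "\<exists>\<rho>\<in>regular_C_Cstar. \<forall>p\<in>C_Cstar. \<forall>u v. omega_C_Cstar p u v = \<rho> p * wedge dz dw p u v"
    by (intro bexI[of _ "laurent_monomial 0 (- 1)"] regular_laurent_monomial)
       (auto simp: omega_C_Cstar_def wedge_def dz_def dw_def laurent_monomial_def
          mem_C_Cstar_iff field_simps)
next
  fix p u
  assume p: "p \<in> C_Cstar" and null: "\<forall>v. omega_C_Cstar p u v = 0"
  from p null[rule_format, of "(1, 0)"] null[rule_format, of "(0, 1)"] show "u = 0"
    by (auto simp: omega_C_Cstar_def wedge_def dz_def dw_def mem_C_Cstar_iff prod_eq_iff)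
qed

theorem lemma3p2:
  "algebraic_symplectic_form C_Cstar regular_C_Cstar omega_C_Cstar \<and>
   algebraic_hamiltonian_density_property C_Cstar regular_C_Cstar omega_C_Cstar"
proof
  show "algebraic_symplectic_form C_Cstar regular_C_Cstar omega_C_Cstar"
    by (rule algebraic_symplectic_form_omega_C_Cstar)
  show "algebraic_hamiltonian_density_property C_Cstar regular_C_Cstar omega_C_Cstar"
    unfolding algebraic_hamiltonian_density_property_def
  proof (intro equalityI subsetI)
    fix V
    assume "V \<in> lie_generated C_Cstar complete_hamiltonian_fields"
    then show "V \<in> HVF_alg C_Cstar regular_C_Cstar omega_C_Cstar"
      by (rule generated_hamiltonian[folded HVF_alg_eq_hamiltonian_fields])
  next
    fix V
    assume "V \<in> HVF_alg C_Cstar regular_C_Cstar omega_C_Cstar"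
    then obtain f where "f \<in> regular_C_Cstar" "V = hamiltonian f"
      unfolding HVF_alg_eq_hamiltonian_fields by (elim imageE)
    then show "V \<in> lie_generated C_Cstar complete_hamiltonian_fields"
      by (simp only: hamiltonian_generated)
  qed
qed

end
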